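(* Let $\zeta:\mathcal H^0_{\mathbb Z}\to\mathbb R$ be the linear map defined by $\zeta(\mathbf 1)=1$ and $$\zeta([s_1,\dots,s_k])=\sum_{n_1>n_2>\cdots>n_k>0}\frac{1}{n_1^{s_1}\cdots n_k^{s_k}}$$ for basis elements $[s_1,\dots,s_k]\in\mathcal H^0_{\mathbb Z}$; these series converge. Then $\zeta$ is an algebra homomorphism from $(\mathcal H^0_{\mathbb Z},\sqcup\!\sqcup)$ to $\mathbb R$. That is, $\zeta(a\sqcup\!\sqcup b)=\zeta(a)\zeta(b)$ for all $a,b\in\mathcal H^0_{\mathbb Z}$.
   Context: Let $\mathcal H_{\mathbb Z}$ be the $\mathbb Q$-vector space with basis $\mathbf 1$ together with the formal symbols $[s_1,\dots,s_k]$ for $k\ge1$ and $(s_1,\dots,s_k)\in\mathbb Z^k$. Let $\mathcal H^0_{\mathbb Z}$ be the span of $\mathbf 1$ together with all $[s_1,\dots,s_k]$ satisfying $s_1+\cdots+s_j>j$ for every $j=1,\dots,k$. It is known that $\mathcal H^0_{\mathbb Z}$ is closed under $\sqcup\!\sqcup$. Define linear maps on basis elements of positive depth by $I([s_1,s_2,\dots,s_k])=[s_1+1,s_2,\dots,s_k]$ and $J([s_1,s_2,\dots,s_k])=[s_1-1,s_2,\dots,s_k]$, and set $J(\mathbf 1)=0$. Notation: for a positive-depth basis element, write $[s_1,\dots,s_k]=[s_1,\vec s\,']$, where $[\vec s\,']=[s_2,\dots,s_k]$, or $\mathbf 1$ if $k=1$. For $a\in\mathbb Z$ and $X=\sum c_{\vec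 v}[\vec v]$, put $[a,X]:=\sum c_{\vec v}[a,\vec v]$, with $[a,\mathbf 1]:=[a]$. The extended shuffle product $\sqcup\!\sqcup$ is the bilinear product with two-sided unit $\mathbf 1$, defined on positive-depth basis elements by the following recursions: <ul> <li>(i) if $s_1=0$: $[0,\vec s\,']\sqcup\!\sqcup[t_1,\vec t\,']=[0,[\vec s\,']\sqcup\!\sqcup[t_1,\vec t\,']]$;</li> <li>(ii) if $s_1>0$ and $t_1=0$: $[s_1,\vec s\,']\sqcup\!\sqcup[0,\vec t\,']=[0,[s_1,\vec s\,']\sqcup\!\sqcup[\vec t\,']]$;</li> <li>(iii) if $s_1,t_1>0$: $[s_1,\vec s\,']\sqcup\!\sqcup[t_1,\vec t\,']=I([s_1,\vec s\,']\sqcup\!\sqcup[t_1-1,\vec t\,'])+I([s_1-1,\vec s\,']\sqcup\!\sqcup[t_1,\vec t\,'])$;</li> <li>(iv) if $s_1>0$ and $t_1<0$: $[s_1,\vec s\,']\sqcup\!\sqcup[t_1,\vec t\,']=J([s_1,\vec s\,']\sqcup\!\sqcup[t_1+1,\vec t\,'])-[s_1-1,\vec s\,']\sqcup\!\sqcup[t_1+1,\vec t\,']$;</li> <li>(v) if $s_1<0$: $[s_1,\vec s\,']\sqcup\!\sqcup[t_1,\vec t\,']=J([s_1+1,\vec s\,']\sqcup\!\sqcup[t_1,\vec t\,'])-[s_1+1,\vec s\,']\sqcup\!\sqcup[t_1-1,\vec t\,']$.</li> </ul> The recursions are well founded: (i) and (ii) by induction on total depth, (iii) on $s_1+t_1$,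 (iv) on $|t_1|$, and (v) on $|s_1|$. *)

theory Defs
  imports "HOL-Analysis.Analysis" "HOL-Library.Poly_Mapping"
begin

text \<open>
  The \<open>\<rat>\<close>-vector space with basis the integer lists is modelled as the finitely
  supported functions from \<open>int list\<close> to \<open>rat\<close>; the empty list is the basis
  element \<open>\<one>\<close>. The type carries no multiplication from the library
  (\<open>int list\<close> is not a monoid), so there is no clash with the shuffle product.
\<close>

type_synonym hz = "int list \<Rightarrow>\<^sub>0 rat"

definition hz_scale :: "rat \<Rightarrow> hz \<Rightarrow> hz" where
  "hz_scale c X = Poly_Mapping.map ((*) c) X"

definition hz_basis :: "int list \<Rightarrow> hz" where
  "hz_basis s = Poly_Mapping.single s 1"

lemma lookup_hz_scale [simp]:
  "Poly_Mapping.lookup (hz_scale c X) s = c * Poly_Mapping.lookup X s"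
  by (simp add: hz_scale_def Poly_Mapping.map.rep_eq when_def)

interpretation hz: vector_space hz_scale
  by unfold_locales
    (auto intro!: poly_mapping_eqI simp: Poly_Mapping.lookup_add algebra_simps)

definition hz_linext :: "(int list \<Rightarrow> hz) \<Rightarrow> hz \<Rightarrow> hz" where
  "hz_linext f X =
     (\<Sum>v\<in>Poly_Mapping.keys X. hz_scale (Poly_Mapping.lookup X v) (f v))"

definition hz_cons :: "int \<Rightarrow> hz \<Rightarrow> hz" where
  "hz_cons a = hz_linext (\<lambda>v. hz_basis (a # v))"

text \<open>
  The operator \<open>I\<close> is only meant for combinations of basis elements of positive
  depth; its value \<open>0\<close> on \<open>\<one>\<close> is a dummy which the recursion below never uses.
  For \<open>J\<close> the value \<open>0\<close> on \<open>\<one>\<close> is part of the definition.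
\<close>

definition hz_I :: "hz \<Rightarrow> hz" where
  "hz_I = hz_linext (\<lambda>v. case v of [] \<Rightarrow> 0 | a # v' \<Rightarrow> hz_basis ((a + 1) # v'))"

definition hz_J :: "hz \<Rightarrow> hz" where
  "hz_J = hz_linext (\<lambda>v. case v of [] \<Rightarrow> 0 | a # v' \<Rightarrow> hz_basis ((a - 1) # v'))"

function shuffle_basis :: "int list \<Rightarrow> int list \<Rightarrow> hz" where
  "shuffle_basis [] t = hz_basis t"
| "shuffle_basis (a # s) [] = hz_basis (a # s)"
| "shuffle_basis (a # s) (b # t) =
     (if a = 0 then hz_cons 0 (shuffle_basis s (b # t))
      else if a > 0 then
        (if b = 0 then hz_cons 0 (shuffle_basis (a # s) t)
         else if b > 0 then
           hz_I (shuffle_basis (a # s) ((b - 1) # t))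
           + hz_I (shuffle_basis ((a - 1) # s) (b # t))
         else
           hz_J (shuffle_basis (a # s) ((b + 1) # t))
           - shuffle_basis ((a - 1) # s) ((b + 1) # t))
      else
        hz_J (shuffle_basis ((a + 1) # s) (b # t))
        - shuffle_basis ((a + 1) # s) ((b - 1) # t))"
  by pat_completeness auto

text \<open>
  Lexicographic descent in: total depth, negative part of the first head, negative
  part of the second head, sum of the two heads.
\<close>

termination
  by (relation "measures
        [\<lambda>(s, t). length s + length t,
         \<lambda>(s, t). nat (- hd s),
         \<lambda>(s, t). nat (- hd t),
         \<lambda>(s, t). nat (hd s + hd t)]") auto

declare shuffle_basis.simps(3) [simp del]

definition shuffle :: "hz \<Rightarrow> hz \<Rightarrow> hz" (infixl "\<squnion>\<squnion>" 70) where
  "X \<squnion>\<squnion> Y =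
     (\<Sum>s\<in>Poly_Mapping.keys X. \<Sum>t\<in>Poly_Mapping.keys Y.
        hz_scale (Poly_Mapping.lookup X s * Poly_Mapping.lookup Y t) (shuffle_basis s t))"

definition admissible :: "int list \<Rightarrow> bool" where
  "admissible s \<longleftrightarrow> (\<forall>j\<in>{1..length s}. sum_list (take j s) > int j)"

text \<open>The empty list is vacuously admissible, so \<open>\<one>\<close> is among the generators.\<close>

definition hz0 :: "hz set" where
  "hz0 = hz.span (hz_basis ` {s. admissible s})"

definition mzv_indices :: "nat \<Rightarrow> nat list set" where
  "mzv_indices k = {ns. length ns = k \<and> sorted_wrt (>) ns \<and> (\<forall>n\<in>set ns. n > 0)}"

definition mzv_term :: "int list \<Rightarrow> nat list \<Rightarrow> real" where
  "mzv_term s ns = 1 / (\<Prod>i<length s. real (ns ! i) powi (s ! i))"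

text \<open>
  All terms are positive, so unconditional summation over the index set is the same
  as any iterated or truncated summation of the series. For the empty list the index
  set is \<open>{[]}\<close> and the sum is \<open>1\<close>.
\<close>

definition mzv :: "int list \<Rightarrow> real" where
  "mzv s = (\<Sum>\<^sub>\<infinity>ns\<in>mzv_indices (length s). mzv_term s ns)"

text \<open>
  The linear extension of \<open>mzv\<close>. It is meaningful on \<open>hz0\<close> only: outside it the series
  may diverge, in which case \<open>infsum\<close> returns \<open>0\<close>.
\<close>

definition zeta_map :: "hz \<Rightarrow> real" where
  "zeta_map X =
     (\<Sum>s\<in>Poly_Mapping.keys X. of_rat (Poly_Mapping.lookup X s) * mzv s)"

end

theory Submission
  imports Defs "HOL-Real_Asymp.Real_Asymp"
begin

text \<open>
  The coefficient at \<open>z\<^sup>n\<close> of the polylogarithm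
  \<open>Li\<^sub>s(z) = \<Sum> z ^ n\<^sub>1 / (n\<^sub>1 powi s\<^sub>1 * \<dots> * n\<^sub>k powi s\<^sub>k)\<close> is a finite sum, so \<open>Li\<^sub>s\<close> is a formal
  power series for every integer list \<open>s\<close>. The Euler operator \<open>z d/dz\<close> lowers the first
  index, hence corresponds to \<open>J\<close>, and prepending \<open>0\<close> is multiplication by \<open>z / (1 - z)\<close>;
  the recursions of the shuffle product are therefore instances of the Leibniz rule, and
  \<open>s \<mapsto> Li\<^sub>s\<close> is multiplicative on all of the algebra. For admissible \<open>s\<close> the coefficients of
  \<open>Li\<^sub>s\<close> are nonnegative with sum \<open>\<zeta>(s)\<close>, and Mertens' theorem on Cauchy products evaluates
  the identity at \<open>z = 1\<close>.
\<close>

unbundle no vec_syntax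
unbundle fps_syntax

section \<open>Linear functionals determined by their values on words\<close>

definition hz_eval :: "(int list \<Rightarrow> real) \<Rightarrow> hz \<Rightarrow> real" where
  "hz_eval g X = (\<Sum>v\<in>Poly_Mapping.keys X. of_rat (Poly_Mapping.lookup X v) * g v)"

lemma hz_eval_superset:
  assumes "finite K" "Poly_Mapping.keys X \<subseteq> K"
  shows "hz_eval g X = (\<Sum>v\<in>K. of_rat (Poly_Mapping.lookup X v) * g v)"
  unfolding hz_eval_def using assms
  by (intro sum.mono_neutral_left) (auto simp: in_keys_iff)

lemma hz_eval_add: "hz_eval g (X + Y) = hz_eval g X + hz_eval g Y"
proof -
  let ?K = "Poly_Mapping.keys X \<union> Poly_Mapping.keys Y"
  have "Poly_Mapping.keys (X + Y) \<subseteq> ?K"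
    by (rule Poly_Mapping.keys_add)
  then show ?thesis
    by (simp add: hz_eval_superset[of ?K] lookup_add of_rat_add ring_distribs sum.distrib)
qed

lemma hz_eval_scale: "hz_eval g (hz_scale c X) = of_rat c * hz_eval g X"
proof -
  have "Poly_Mapping.keys (hz_scale c X) \<subseteq> Poly_Mapping.keys X"
    by (auto simp: in_keys_iff)
  then show ?thesis
    by (simp add: hz_eval_superset[of "Poly_Mapping.keys X"] of_rat_mult sum_distrib_left mult.assoc)
qed

lemma hz_eval_zero [simp]: "hz_eval g 0 = 0"
  by (simp add: hz_eval_def)

lemma hz_eval_diff: "hz_eval g (X - Y) = hz_eval g X - hz_eval g Y"
  using hz_eval_add[of g "X - Y" Y] by simp

lemma hz_eval_sum: "hz_eval g (\<Sum>i\<in>A. F i) = (\<Sum>i\<in>A. hz_eval g (F i))"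
  by (induction A rule: infinite_finite_induct) (simp_all add: hz_eval_add)

lemma hz_eval_basis [simp]: "hz_eval g (hz_basis s) = g s"
  by (simp add: hz_eval_def hz_basis_def)

lemma hz_eval_linext: "hz_eval g (hz_linext f X) = hz_eval (\<lambda>v. hz_eval g (f v)) X"
  by (simp add: hz_linext_def hz_eval_sum hz_eval_scale hz_eval_def[of _ X])

lemma hz_eval_cong: "(\<And>v. v \<in> Poly_Mapping.keys X \<Longrightarrow> g v = h v) \<Longrightarrow> hz_eval g X = hz_eval h X"
  by (simp add: hz_eval_def)

lemma hz_eval_mult_left: "hz_eval (\<lambda>v. c * g v) X = c * hz_eval g X"
  by (simp add: hz_eval_def sum_distrib_left algebra_simps)

lemma hz_eval_sum_left: "hz_eval (\<lambda>v. \<Sum>i\<in>A. g i v) X = (\<Sum>i\<in>A. hz_eval (g i) X)"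
  by (simp add: hz_eval_def sum_distrib_left sum.swap[of _ A])

lemma hz_eval_shuffle:
  "hz_eval g (X \<squnion>\<squnion> Y) = hz_eval (\<lambda>s. hz_eval (\<lambda>t. hz_eval g (shuffle_basis s t)) Y) X"
  by (simp add: shuffle_def hz_eval_sum hz_eval_scale of_rat_mult hz_eval_def[of _ X] hz_eval_def[of _ Y]
      sum_distrib_left mult.assoc)

section \<open>Polylogarithms as formal power series\<close>

text \<open>The coefficient at \<open>n\<close> collects the terms with largest index
  \<open>n\<close>, and \<open>m\<close> is the next index. For a nonempty word the coefficient at
  \<open>0\<close> is an empty sum times a factor, so it vanishes whatever
  \<open>0 powi (- a)\<close> is.\<close>

primrec polylog :: "int list \<Rightarrow> real fps" where
  "polylog [] = 1"
| "polylog (a # s) = Abs_fps (\<lambda>n. real n powi (- a) * (\<Sum>m<n. polylog s $ m))"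

lemma polylog_nonneg: "polylog s $ n \<ge> 0"
  by (induction s arbitrary: n) (auto intro!: mult_nonneg_nonneg sum_nonneg zero_le_power_int simp: fps_one_nth)

lemma polylog_pred: "polylog ((a - 1) # s) $ n = real n * polylog (a # s) $ n"
proof (cases "n = 0")
  case False
  then have "real n powi (1 - a) = real n * real n powi (- a)"
    by (simp add: power_int_diff power_int_minus field_simps)
  then show ?thesis by simp
qed simp

text \<open>Division by zero yields \<open>0\<close>, which agrees with the vanishing coefficient at
  \<open>n = 0\<close>.\<close>

lemma polylog_succ: "polylog ((a + 1) # s) $ n = polylog (a # s) $ n / real n"
  using polylog_pred[of "a + 1" s n] by (cases "n = 0") auto

lemma fps_XD_polylog: "fps_XD (polylog (a # s)) = polylog ((a - 1) # s)"
  by (rule fps_ext) (simp only: polylog_pred fps_XD_nth)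

section \<open>Multiplicativity of the polylogarithm map\<close>

definition phi :: "hz \<Rightarrow> real fps" where
  "phi X = Abs_fps (\<lambda>n. hz_eval (\<lambda>v. polylog v $ n) X)"

lemma phi_nth [simp]: "phi X $ n = hz_eval (\<lambda>v. polylog v $ n) X"
  by (simp add: phi_def)


lemma phi_add: "phi (X + Y) = phi X + phi Y"
  by (rule fps_ext) (simp add: hz_eval_add)

lemma phi_diff: "phi (X - Y) = phi X - phi Y"
  by (rule fps_ext) (simp add: hz_eval_diff)

lemma phi_basis [simp]: "phi (hz_basis s) = polylog s"
  by (rule fps_ext) simp

lemma phi_J: "phi (hz_J X) = fps_XD (phi X)"
proof (rule fps_ext)
  fix n
  \<comment> \<open>For \<open>v = []\<close> this says that the Euler operator kills constants, in
    agreement with \<open>J\<close> sending the unit to \<open>0\<close>.\<close>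
  have "hz_eval (\<lambda>w. polylog w $ n) (case v of [] \<Rightarrow> 0 | a # v' \<Rightarrow> hz_basis ((a - 1) # v'))
      = real n * polylog v $ n" for v
    by (cases v) (simp_all add: polylog_pred fps_one_nth del: polylog.simps(2))
  then show "phi (hz_J X) $ n = fps_XD (phi X) $ n"
    by (simp add: hz_J_def hz_eval_linext hz_eval_mult_left)
qed

text \<open>\<open>hz_I\<close> inverts the Euler operator away from the constant term. Its dummy
  value \<open>0\<close> at \<open>[]\<close> fits: the series \<open>1\<close> has no coefficient
  at \<open>n > 0\<close>, and at \<open>n = 0\<close> division by zero gives
  \<open>0\<close>.\<close>

lemma phi_I_nth: "phi (hz_I X) $ n = phi X $ n / real n"
proof -
  have "hz_eval (\<lambda>w. polylog w $ n) (case v of [] \<Rightarrow> 0 | a # v' \<Rightarrow> hz_basis ((a + 1) # v'))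
      = inverse (real n) * polylog v $ n" for v
    by (cases v) (simp_all add: polylog_succ fps_one_nth field_simps del: polylog.simps(2))
  then show ?thesis
    unfolding phi_nth hz_I_def hz_eval_linext by (simp only: hz_eval_mult_left) (simp add: field_simps)
qed

text \<open>The series \<open>z / (1 - z)\<close>; multiplying by it forms strict partial sums of
  coefficients.\<close>

definition geom :: "real fps" where
  "geom = Abs_fps (\<lambda>n. if n = 0 then 0 else 1)"

lemma geom_mult_nth: "(geom * F) $ n = (\<Sum>m<n. F $ m)"
proof -
  have "(geom * F) $ n = (\<Sum>i=0..n. F $ i * geom $ (n - i))"
    by (simp only: mult.commute[of geom] fps_mult_nth)
  also have "\<dots> = (\<Sum>i<n. F $ i)"
    by (intro sum.mono_neutral_cong_right) (auto simp: geom_def)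
  finally show ?thesis .
qed

lemma polylog_0: "polylog (0 # s) = geom * polylog s"
  by (rule fps_ext) (simp add: geom_mult_nth)

lemma phi_cons_0: "phi (hz_cons 0 X) = geom * phi X"
  by (rule fps_ext)
    (simp add: hz_cons_def hz_eval_linext geom_mult_nth hz_eval_sum_left)

text \<open>A head \<open>0\<close> pulls out a factor \<open>geom\<close>. Two positive heads
  integrate the Leibniz rule, and a negative head solves the Leibniz rule for one of its two
  products.\<close>

lemma phi_shuffle_basis: "phi (shuffle_basis s t) = polylog s * polylog t"
proof (induction s t rule: shuffle_basis.induct)
  case (3 a s b t)
  let ?A = "polylog (a # s)" and ?B = "polylog (b # t)"
  have Leibniz: "fps_XD (F * G) = F * fps_XD G + fps_XD F * G" for F G :: "real fps"
    by (simp add: fps_XD_def algebra_simps)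
  consider "a = 0" | "a > 0" "b = 0" | "a > 0" "b > 0" | "a > 0" "b < 0" | "a < 0"
    by linarith
  then show ?case
  proof cases
    case 1
    then show ?thesis
      using 3(1) by (simp add: shuffle_basis.simps(3) phi_cons_0 polylog_0 mult.assoc del: polylog.simps(2))
  next
    case 2
    then show ?thesis
      using 3(2) by (simp add: shuffle_basis.simps(3) phi_cons_0 polylog_0 mult.left_commute del: polylog.simps(2))
  next
    case 3
    have "phi (shuffle_basis (a # s) (b # t)) $ n = (?A * ?B) $ n" for n
    proof -
      have "phi (shuffle_basis (a # s) (b # t)) $ n
          = (?A * fps_XD ?B + fps_XD ?A * ?B) $ n / real n"
        using 3 "3.IH"(3,4)
        by (simp add: shuffle_basis.simps(3) phi_add phi_I_nth fps_XD_polylog add_divide_distrib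
            del: polylog.simps(2) phi_nth fps_XD_nth)
      also have "\<dots> = real n * (?A * ?B) $ n / real n"
        by (simp only: Leibniz[symmetric] fps_XD_nth)
      \<comment> \<open>Dividing by \<open>n\<close> loses the constant term, but that of
        \<open>?A * ?B\<close> is \<open>0\<close> since both words are nonempty.\<close>
      also have "\<dots> = (?A * ?B) $ n"
        by (cases "n = 0") simp_all
      finally show ?thesis .
    qed
    then show ?thesis by (rule fps_ext)
  next
    case 4
    have "phi (shuffle_basis (a # s) (b # t))
        = fps_XD (?A * polylog ((b + 1) # t)) - fps_XD ?A * polylog ((b + 1) # t)"
      using 4 "3.IH"(5,6)
      by (simp add: shuffle_basis.simps(3) phi_diff phi_J fps_XD_polylog del: polylog.simps(2))
    also have "\<dots> = ?A * ?B"
      by (simp add: Leibniz fps_XD_polylog del: polylog.simps(2))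
    finally show ?thesis .
  next
    case 5
    have "phi (shuffle_basis (a # s) (b # t))
        = fps_XD (polylog ((a + 1) # s) * ?B) - polylog ((a + 1) # s) * fps_XD ?B"
      using 5 "3.IH"(7,8)
      by (simp add: shuffle_basis.simps(3) phi_diff phi_J fps_XD_polylog del: polylog.simps(2))
    also have "\<dots> = ?A * ?B"
      by (simp add: Leibniz fps_XD_polylog del: polylog.simps(2))
    finally show ?thesis .
  qed
qed simp_all

section \<open>Closure of the admissible span under the shuffle product\<close>

text \<open>
  If \<open>x\<close> is the minimum of \<open>s\<^sub>1 + \<dots> + s\<^sub>j - j\<close>, the coefficients of \<open>Li\<^sub>s\<close> decay like
  \<open>n powr (- x - 1)\<close> up to logarithms. The convolution of two such sequences suggests the
  exponent \<open>min (min x y) (x + y)\<close> below. Non-admissible words have to be included because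
  the recursion of the shuffle product passes through them.
\<close>

primrec excess_ge :: "int list \<Rightarrow> int \<Rightarrow> bool" where
  "excess_ge [] x = True"
| "excess_ge (a # s) x = (x \<le> a - 1 \<and> excess_ge s (x - (a - 1)))"

text \<open>Each letter \<open>a\<close> contributes \<open>a - 1\<close> to the excess of a prefix,
  and the recursion passes the remaining requirement on to the tail.\<close>

lemma excess_ge_iff:
  "excess_ge s x \<longleftrightarrow> (\<forall>j\<in>{1..length s}. sum_list (take j s) \<ge> int j + x)"
proof (induction s arbitrary: x)
  case (Cons a s)
  have "(\<forall>j\<in>{1..length (a # s)}. P j) \<longleftrightarrow> P 1 \<and> (\<forall>j\<in>{1..length s}. P (Suc j))" for P
    by (auto simp: Ball_def Suc_le_eq) (metis Suc_le_mono Suc_pred le_zero_eq neq0_conv)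
  then show ?case
    by (simp add: Cons.IH algebra_simps)
qed simp

lemma admissible_iff: "admissible s \<longleftrightarrow> excess_ge s 1"
  by (auto simp: admissible_def excess_ge_iff)

lemma excess_ge_antimono: "excess_ge s x \<Longrightarrow> y \<le> x \<Longrightarrow> excess_ge s y"
  by (force simp: excess_ge_iff)

definition all_excess_ge :: "hz \<Rightarrow> int \<Rightarrow> bool" where
  "all_excess_ge X x \<longleftrightarrow> (\<forall>v\<in>Poly_Mapping.keys X. excess_ge v x)"

lemma all_excess_ge_antimono: "all_excess_ge X x \<Longrightarrow> y \<le> x \<Longrightarrow> all_excess_ge X y"
  by (auto simp: all_excess_ge_def intro: excess_ge_antimono)

lemma all_excess_ge_basis [simp]: "all_excess_ge (hz_basis s) x \<longleftrightarrow> excess_ge s x"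
  by (simp add: all_excess_ge_def hz_basis_def)

lemma all_excess_ge_0 [simp]: "all_excess_ge 0 x"
  by (simp add: all_excess_ge_def)

lemma all_excess_ge_scale: "all_excess_ge X x \<Longrightarrow> all_excess_ge (hz_scale c X) x"
  by (auto simp: all_excess_ge_def in_keys_iff)

lemma all_excess_ge_add:
  "all_excess_ge X x \<Longrightarrow> all_excess_ge Y x \<Longrightarrow> all_excess_ge (X + Y) x"
  using Poly_Mapping.keys_add[of X Y] by (auto simp: all_excess_ge_def)

lemma all_excess_ge_diff:
  "all_excess_ge X x \<Longrightarrow> all_excess_ge Y x \<Longrightarrow> all_excess_ge (X - Y) x"
  using Poly_Mapping.keys_diff[of X Y] by (auto simp: all_excess_ge_def)

lemma all_excess_ge_linext:
  assumes "\<And>v. v \<in> Poly_Mapping.keys X \<Longrightarrow> all_excess_ge (f v) x"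
  shows "all_excess_ge (hz_linext f X) x"
proof -
  have "all_excess_ge (\<Sum>v\<in>A. hz_scale (Poly_Mapping.lookup X v) (f v)) x"
    if "A \<subseteq> Poly_Mapping.keys X" for A
    using finite_subset[OF that finite_keys] that
    by (induction A) (auto intro!: all_excess_ge_add all_excess_ge_scale assms)
  then show ?thesis
    by (simp add: hz_linext_def)
qed

lemma all_excess_geD: "all_excess_ge X x \<Longrightarrow> v \<in> Poly_Mapping.keys X \<Longrightarrow> excess_ge v x"
  by (simp add: all_excess_ge_def)

text \<open>A leading \<open>0\<close> lowers every later excess by one and adds a one-letter prefix
  of excess \<open>-1\<close>.\<close>

lemma all_excess_ge_cons_0:
  "all_excess_ge X (x + 1) \<Longrightarrow> x \<le> - 1 \<Longrightarrow> all_excess_ge (hz_cons 0 X) x"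
  unfolding hz_cons_def
  by (rule all_excess_ge_linext) (auto dest: all_excess_geD)

lemma all_excess_ge_I: "all_excess_ge X (x - 1) \<Longrightarrow> all_excess_ge (hz_I X) x"
  unfolding hz_I_def
  by (rule all_excess_ge_linext) (auto dest!: all_excess_geD simp: algebra_simps split: list.split)

lemma all_excess_ge_J: "all_excess_ge X (x + 1) \<Longrightarrow> all_excess_ge (hz_J X) x"
  unfolding hz_J_def
  by (rule all_excess_ge_linext) (auto dest!: all_excess_geD simp: algebra_simps split: list.split)

text \<open>The bound survives every recursion step. When a head is zero or negative, its own bound
  is negative, so \<open>x + y\<close> lies strictly below the other bound and leaves room for the
  shift. For \<open>x = y = 1\<close> the bound is again \<open>1\<close>.\<close>

lemma all_excess_ge_shuffle_basis:
  assumes "excess_ge s x" "excess_ge t y"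
  shows "all_excess_ge (shuffle_basis s t) (min (min x y) (x + y))"
  using assms
proof (induction s t arbitrary: x y rule: shuffle_basis.induct)
  case (3 a s b t)
  define m where "m = min (min x y) (x + y)"
  have x: "x \<le> a - 1" "excess_ge s (x - (a - 1))" and y: "y \<le> b - 1" "excess_ge t (y - (b - 1))"
    using "3.prems" by auto
  have shift_a: "excess_ge ((a + d) # s) (x + d)" for d
    using x by (simp add: algebra_simps)
  have shift_b: "excess_ge ((b + d) # t) (y + d)" for d
    using y by (simp add: algebra_simps)
  consider "a = 0" | "a > 0" "b = 0" | "a > 0" "b > 0" | "a > 0" "b < 0" | "a < 0"
    by linarith
  then have "all_excess_ge (shuffle_basis (a # s) (b # t)) m"
  proof cases
    case 1
    have "all_excess_ge (shuffle_basis s (b # t)) (m + 1)"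
      by (rule all_excess_ge_antimono[OF "3.IH"(1)[of "x + 1" y]])
        (use 1 x "3.prems" in \<open>auto simp: m_def\<close>)
    then show ?thesis
      using 1 x by (auto simp: shuffle_basis.simps(3) m_def intro!: all_excess_ge_cons_0)
  next
    case 2
    have "all_excess_ge (shuffle_basis (a # s) t) (m + 1)"
      by (rule all_excess_ge_antimono[OF "3.IH"(2)[of x "y + 1"]])
        (use 2 y "3.prems" in \<open>auto simp: m_def\<close>)
    then show ?thesis
      using 2 y by (auto simp: shuffle_basis.simps(3) m_def intro!: all_excess_ge_cons_0)
  next
    case 3
    have "all_excess_ge (shuffle_basis (a # s) ((b - 1) # t)) (m - 1)"
      by (rule all_excess_ge_antimono[OF "3.IH"(3)[of x "y - 1"]])
        (use 3 "3.prems" shift_b[of "- 1"] in \<open>auto simp: m_def\<close>)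
    moreover have "all_excess_ge (shuffle_basis ((a - 1) # s) (b # t)) (m - 1)"
      by (rule all_excess_ge_antimono[OF "3.IH"(4)[of "x - 1" y]])
        (use 3 "3.prems" shift_a[of "- 1"] in \<open>auto simp: m_def\<close>)
    ultimately show ?thesis
      using 3 by (simp add: shuffle_basis.simps(3) all_excess_ge_add all_excess_ge_I)
  next
    case 4
    have "all_excess_ge (shuffle_basis (a # s) ((b + 1) # t)) (m + 1)"
      by (rule all_excess_ge_antimono[OF "3.IH"(5)[of x "y + 1"]])
        (use 4 "3.prems" shift_b[of 1] y in \<open>auto simp: m_def\<close>)
    moreover have "all_excess_ge (shuffle_basis ((a - 1) # s) ((b + 1) # t)) m"
      by (rule all_excess_ge_antimono[OF "3.IH"(6)[of "x - 1" "y + 1"]])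
        (use 4 "3.prems" shift_a[of "- 1"] shift_b[of 1] y in \<open>auto simp: m_def\<close>)
    ultimately show ?thesis
      using 4 by (simp add: shuffle_basis.simps(3) all_excess_ge_diff all_excess_ge_J)
  next
    case 5
    have "all_excess_ge (shuffle_basis ((a + 1) # s) (b # t)) (m + 1)"
      by (rule all_excess_ge_antimono[OF "3.IH"(7)[of "x + 1" y]])
        (use 5 "3.prems" shift_a[of 1] x in \<open>auto simp: m_def\<close>)
    moreover have "all_excess_ge (shuffle_basis ((a + 1) # s) ((b - 1) # t)) m"
      by (rule all_excess_ge_antimono[OF "3.IH"(8)[of "x + 1" "y - 1"]])
        (use 5 "3.prems" shift_a[of 1] shift_b[of "- 1"] x in \<open>auto simp: m_def\<close>)
    ultimately show ?thesis
      using 5 by (simp add: shuffle_basis.simps(3) all_excess_ge_diff all_excess_ge_J)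
  qed
  then show ?case by (simp add: m_def)
qed (auto intro: excess_ge_antimono)

text \<open>A span of basis elements is described by supports, which turns membership into a
  condition on words.\<close>

lemma hz0_iff: "X \<in> hz0 \<longleftrightarrow> all_excess_ge X 1"
proof
  assume "X \<in> hz0"
  then show "all_excess_ge X 1"
    unfolding hz0_def
    by (induction rule: hz.span_induct_alt)
      (auto simp: admissible_iff intro!: all_excess_ge_add all_excess_ge_scale)
next
  assume X: "all_excess_ge X 1"
  have "X = (\<Sum>v\<in>Poly_Mapping.keys X. hz_scale (Poly_Mapping.lookup X v) (hz_basis v))"
    by (rule poly_mapping_eqI)
      (simp add: lookup_sum hz_basis_def lookup_single when_def in_keys_iff sum.delta' if_distrib
        cong: if_cong)
  also have "\<dots> \<in> hz0"
    unfolding hz0_def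
    by (intro hz.span_sum hz.span_scale hz.span_base)
      (use X in \<open>auto simp: all_excess_ge_def admissible_iff\<close>)
  finally show "X \<in> hz0" .
qed

lemma shuffle_basis_in_hz0: "excess_ge s 1 \<Longrightarrow> excess_ge t 1 \<Longrightarrow> shuffle_basis s t \<in> hz0"
  using all_excess_ge_shuffle_basis[of s 1 t 1] by (simp add: hz0_iff)

lemma shuffle_in_hz0:
  assumes "X \<in> hz0" "Y \<in> hz0"
  shows "X \<squnion>\<squnion> Y \<in> hz0"
proof -
  have "shuffle_basis s t \<in> hz0"
    if "s \<in> Poly_Mapping.keys X" "t \<in> Poly_Mapping.keys Y" for s t
    using assms that by (auto simp: hz0_iff[of X] hz0_iff[of Y] all_excess_ge_def
        intro: shuffle_basis_in_hz0)
  then show ?thesis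
    unfolding shuffle_def hz0_def by (intro hz.span_sum hz.span_scale) auto
qed

section \<open>Growth of the coefficients and convergence\<close>

text \<open>Partial sums are bounded because they are the inner sums of the next coefficient. Each
  letter costs one harmonic factor.\<close>

lemma polylog_partial_sum_le:
  assumes "excess_ge s (- int x)" "n > 0"
  shows "(\<Sum>m<n. polylog s $ m) \<le> real n ^ x * harm n ^ length s"
  using assms
proof (induction s arbitrary: x n)
  case Nil
  then have "(\<Sum>m<n. (1 :: real fps) $ m) = 1"
    by (simp add: fps_one_nth)
  then show ?case using Nil by simp
next
  case (Cons a s)
  \<comment> \<open>The tail has excess at least \<open>- y\<close>; \<open>nat\<close> truncates
    nothing, because the first letter satisfies \<open>- x \<le> a - 1\<close>.\<close>
  define y where "y = nat (int x + a - 1)"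
  have y: "int y = int x + a - 1" "excess_ge s (- int y)"
    using Cons.prems by (auto simp: y_def algebra_simps)
  have le: "polylog (a # s) $ m \<le> inverse (real m) * (real n ^ x * harm n ^ length s)"
    if "m < n" for m
  proof (cases "m = 0")
    case False
    have "polylog (a # s) $ m \<le> real m powi (- a) * (real m ^ y * harm m ^ length s)"
      using Cons.IH[OF y(2), of m] False by (auto intro!: mult_left_mono)
    also have "real m powi (- a) * (real m ^ y * harm m ^ length s)
        = real m powi (- a + int y) * harm m ^ length s"
      using False power_int_add[of "real m" "- a" "int y"] by simp
    \<comment> \<open>The exponent \<open>- a + y\<close> equals \<open>x - 1\<close>; the split-off
      \<open>1 / m\<close> sums to the new harmonic factor.\<close>
    also have "real m powi (- a + int y) = inverse (real m) * real m ^ x"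
      using False y(1) power_int_add[of "real m" "- 1" "int x"] by (simp add: power_int_minus)
    also have "inverse (real m) * real m ^ x * harm m ^ length s
        \<le> inverse (real m) * (real n ^ x * harm n ^ length s)"
      unfolding mult.assoc using that
      by (intro mult_left_mono mult_mono power_mono harm_mono) (auto simp: harm_nonneg)
    finally show ?thesis .
  qed simp
  have "(\<Sum>m<n. polylog (a # s) $ m)
      \<le> (\<Sum>m<n. inverse (real m) * (real n ^ x * harm n ^ length s))"
    using le by (intro sum_mono) auto
  also have "\<dots> = (\<Sum>m<n. inverse (real m)) * (real n ^ x * harm n ^ length s)"
    by (simp add: sum_distrib_right)
  also have "(\<Sum>m<n. inverse (real m)) = (\<Sum>m\<in>{1..<n}. inverse (real m))"
    by (intro sum.mono_neutral_right) auto
  also have "\<dots> \<le> harm n"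
    unfolding harm_def by (intro sum_mono2) auto
  finally show ?case
    by (simp add: mult_right_mono harm_nonneg mult.left_commute)
qed

text \<open>\<open>harm n - ln n\<close> decreases from its value \<open>1\<close> at
  \<open>n = 1\<close>.\<close>

lemma harm_le_ln: "n > 0 \<Longrightarrow> harm n \<le> 1 + ln (real n)"
  using decseq_harm_diff_ln[THEN decseqD, of 0 "n - 1"] by (simp add: harm_expand)

text \<open>The tail has excess at least \<open>2 - a\<close>, so its partial sums grow like
  \<open>n ^ (a - 2)\<close> up to logarithms, and the factor \<open>n powi (- a)\<close> leaves
  order \<open>1 / n ^ 2\<close>.\<close>

lemma summable_polylog:
  assumes "excess_ge s 1"
  shows "summable (\<lambda>n. polylog s $ n)"
proof (cases s)
  case Nil
  then show ?thesis by (simp add: fps_one_nth)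
next
  case (Cons a s')
  let ?k = "length s'"
  have a: "a \<ge> 2" "excess_ge s' (- int (nat (a - 2)))"
    using assms Cons by auto
  have "polylog s $ n \<le> (1 + ln (real n)) ^ ?k / real n ^ 2" if "n > 0" for n
  proof -
    have "polylog s $ n \<le> real n powi (- a) * (real n ^ nat (a - 2) * harm n ^ ?k)"
      using polylog_partial_sum_le[OF a(2) that] by (auto simp: Cons intro!: mult_left_mono)
    also have "\<dots> = harm n ^ ?k * (real n powi (- a) * real n powi (a - 2))"
      using a(1) by (simp add: power_int_def)
    also have "real n powi (- a) * real n powi (a - 2) = 1 / real n ^ 2"
      using that by (simp add: power_int_diff power_int_minus field_simps)
    also have "harm n ^ ?k * (1 / real n ^ 2) \<le> (1 + ln (real n)) ^ ?k / real n ^ 2"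
      using harm_le_ln[OF that] by (auto intro!: divide_right_mono power_mono harm_nonneg)
    finally show ?thesis .
  qed
  then have "\<forall>\<^sub>F n in sequentially. norm (polylog s $ n) \<le> (1 + ln (real n)) ^ ?k / real n ^ 2"
    using polylog_nonneg by (intro eventually_sequentiallyI[of 1]) auto
  moreover have "summable (\<lambda>n. (1 + ln (real n)) ^ ?k / real n ^ 2)"
  proof (rule summable_comparison_test_bigo)
    \<comment> \<open>Any exponent strictly between \<open>-2\<close> and \<open>-1\<close> absorbs
      the logarithms and stays summable.\<close>
    show "summable (\<lambda>n. norm (real n powr - (3 / 2)))"
      by (simp add: summable_real_powr_iff)
    show "(\<lambda>n. (1 + ln (real n)) ^ ?k / real n ^ 2) \<in> O(\<lambda>n. real n powr - (3 / 2))"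
      by real_asymp
  qed
  ultimately show ?thesis
    by (rule summable_comparison_test_ev)
qed

section \<open>Multiple zeta series as sums of polylogarithm coefficients\<close>

definition mzv_indices_below :: "nat \<Rightarrow> nat \<Rightarrow> nat list set" where
  "mzv_indices_below k n = {ns \<in> mzv_indices k. \<forall>m\<in>set ns. m < n}"

lemma mzv_indices_below_0: "mzv_indices_below 0 n = {[]}"
  by (auto simp: mzv_indices_below_def mzv_indices_def)

lemma mzv_indices_Suc:
  "mzv_indices (Suc k) = (\<lambda>(m, ns). m # ns) ` Sigma {1..} (mzv_indices_below k)"
  by (force simp: mzv_indices_below_def mzv_indices_def length_Suc_conv image_iff)

lemma mzv_indices_below_Suc:
  "mzv_indices_below (Suc k) n = (\<lambda>(m, ns). m # ns) ` Sigma {1..<n} (mzv_indices_below k)"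
  by (force simp: mzv_indices_below_def mzv_indices_def length_Suc_conv image_iff)

lemma mzv_indices_0: "mzv_indices 0 = {[]}"
  by (auto simp: mzv_indices_def)

lemma finite_mzv_indices_below: "finite (mzv_indices_below k n)"
  by (induction k arbitrary: n) (auto simp: mzv_indices_below_0 mzv_indices_below_Suc)

lemma mzv_term_Cons: "mzv_term (a # s) (n # ns) = real n powi (- a) * mzv_term s ns"
  by (simp add: mzv_term_def prod.lessThan_Suc_shift power_int_minus field_simps
      del: prod.lessThan_Suc)

lemma mzv_term_nonneg: "mzv_term s ns \<ge> 0"
  by (auto simp: mzv_term_def intro!: divide_nonneg_nonneg prod_nonneg)

lemma inj_on_Cons: "inj_on (\<lambda>(m, ns). m # ns) A"
  by (auto simp: inj_on_def)

text \<open>Splitting off the largest index reproduces the recursion of \<open>polylog\<close>. For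
  \<open>n = 0\<close> the empty word would give \<open>1\<close> on the left and \<open>0\<close>
  on the right.\<close>

lemma sum_mzv_term_below:
  "n > 0 \<Longrightarrow> (\<Sum>ns\<in>mzv_indices_below (length s) n. mzv_term s ns) = (\<Sum>m<n. polylog s $ m)"
proof (induction s arbitrary: n)
  case Nil
  then show ?case
    by (simp add: mzv_indices_below_0 mzv_term_def fps_one_nth)
next
  case (Cons a s)
  have "(\<Sum>ns\<in>mzv_indices_below (length (a # s)) n. mzv_term (a # s) ns)
      = (\<Sum>(m, ns)\<in>Sigma {1..<n} (mzv_indices_below (length s)). mzv_term (a # s) (m # ns))"
    by (simp only: mzv_indices_below_Suc length_Cons sum.reindex[OF inj_on_Cons])
      (simp add: case_prod_unfold)
  also have "\<dots> = (\<Sum>m=1..<n. polylog (a # s) $ m)"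
    by (simp add: sum.Sigma[symmetric] finite_mzv_indices_below mzv_term_Cons
        sum_distrib_left[symmetric] Cons.IH)
  also have "\<dots> = (\<Sum>m<n. polylog (a # s) $ m)"
    by (intro sum.mono_neutral_left) (auto simp: not_less_eq_eq)
  finally show ?case .
qed

text \<open>The index set is fibred over its largest entry \<open>n\<close>; each fibre is finite
  with sum \<open>polylog s $ n\<close>, and nonnegative terms allow summation fibre by
  fibre.\<close>

lemma has_sum_mzv:
  assumes "excess_ge s 1"
  shows "(mzv_term s has_sum suminf (fps_nth (polylog s))) (mzv_indices (length s))"
proof (cases s)
  case Nil
  have "suminf (fps_nth (1 :: real fps)) = (\<Sum>n\<in>{0}. (1 :: real fps) $ n)"
    by (rule suminf_finite) (auto simp: fps_one_nth)
  then show ?thesis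
    using Nil by (simp add: has_sum_finite_iff mzv_indices_0 mzv_term_def)
next
  case (Cons a s')
  let ?f = "\<lambda>(n, ns). mzv_term s (n # ns)"
  let ?B = "mzv_indices_below (length s')"
  have inner: "((\<lambda>ns. ?f (n, ns)) has_sum polylog s $ n) (?B n)" if "n \<in> {1..}" for n
    using that
    by (simp add: has_sum_finite_iff finite_mzv_indices_below Cons mzv_term_Cons
        sum_distrib_left[symmetric] sum_mzv_term_below)
  have "((\<lambda>n. polylog s $ n) has_sum suminf (fps_nth (polylog s))) UNIV"
    by (intro sums_nonneg_imp_has_sum summable_sums summable_polylog assms polylog_nonneg)
  \<comment> \<open>The index \<open>0\<close> may be dropped since a nonempty word has coefficient
    \<open>0\<close> there.\<close>
  then have outer: "((\<lambda>n. polylog s $ n) has_sum suminf (fps_nth (polylog s))) {1..}"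
    by (rule has_sum_cong_neutral[THEN iffD1, rotated -1]) (auto simp: Cons not_le)
  have "?f summable_on Sigma {1..} ?B"
  proof (rule summable_on_SigmaI)
    show "(\<lambda>n. polylog s $ n) summable_on {1..}"
      using outer by (auto simp: summable_on_def)
  qed (use inner mzv_term_nonneg in auto)
  from has_sum_SigmaI[OF inner outer this]
  have "(?f has_sum suminf (fps_nth (polylog s))) (Sigma {1..} ?B)" by simp
  then show ?thesis
    by (simp only: Cons length_Cons mzv_indices_Suc has_sum_reindex[OF inj_on_Cons])
      (simp only: o_def case_prod_unfold)
qed

lemma mzv_eq_suminf: "excess_ge s 1 \<Longrightarrow> mzv s = suminf (fps_nth (polylog s))"
  unfolding mzv_def by (rule infsumI[OF has_sum_mzv])

lemma zeta_map_eq_ev: "zeta_map = hz_eval mzv"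
  by (simp add: zeta_map_def hz_eval_def fun_eq_iff)

section \<open>Evaluation at \<open>z = 1\<close>\<close>

lemma zeta_map_sums:
  assumes "X \<in> hz0"
  shows "(\<lambda>n. phi X $ n) sums zeta_map X"
proof -
  have "(\<lambda>n. polylog v $ n) sums mzv v" if "v \<in> Poly_Mapping.keys X" for v
    using assms that
    by (auto simp: hz0_iff all_excess_ge_def mzv_eq_suminf intro!: summable_sums summable_polylog)
  then show ?thesis
    by (auto simp: zeta_map_def hz_eval_def intro!: sums_sum sums_mult)
qed

text \<open>Both sides are sums of the same series by \<open>phi_shuffle_basis\<close>. Closure of
  \<open>hz0\<close> ensures that this series converges to \<open>zeta_map\<close> of the
  product.\<close>

lemma zeta_map_shuffle_basis:
  assumes "excess_ge s 1" "excess_ge t 1"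
  shows "zeta_map (shuffle_basis s t) = mzv s * mzv t"
proof -
  have abs: "summable (\<lambda>n. norm (polylog v $ n))" if "excess_ge v 1" for v
    using summable_polylog[OF that] by (simp add: polylog_nonneg)
  have "(\<lambda>n. \<Sum>i\<le>n. polylog s $ i * polylog t $ (n - i)) sums (mzv s * mzv t)"
    using Cauchy_product_sums[OF abs abs] assms by (simp add: mzv_eq_suminf)
  moreover have "(\<lambda>n. phi (shuffle_basis s t) $ n) sums zeta_map (shuffle_basis s t)"
    by (intro zeta_map_sums shuffle_basis_in_hz0 assms)
  ultimately show ?thesis
    by (simp add: phi_shuffle_basis fps_mult_nth atLeast0AtMost sums_unique2 del: phi_nth)
qed

lemma zeta_map_shuffle:
  assumes "X \<in> hz0" "Y \<in> hz0"
  shows "zeta_map (X \<squnion>\<squnion> Y) = zeta_map X * zeta_map Y"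
proof -
  have "zeta_map (X \<squnion>\<squnion> Y) = hz_eval (\<lambda>s. hz_eval (\<lambda>t. mzv s * mzv t) Y) X"
    unfolding zeta_map_eq_ev hz_eval_shuffle
    using assms zeta_map_shuffle_basis
    by (intro hz_eval_cong) (auto simp: hz0_iff all_excess_ge_def zeta_map_eq_ev)
  also have "\<dots> = zeta_map X * zeta_map Y"
    by (simp add: hz_eval_mult_left mult.commute[of _ "hz_eval mzv Y"] zeta_map_eq_ev)
  finally show ?thesis .
qed

theorem theorem4p8:
  shows "(\<forall>s. admissible s \<longrightarrow> mzv_term s summable_on mzv_indices (length s))
    \<and> (\<forall>a\<in>hz0. \<forall>b\<in>hz0. a \<squnion>\<squnion> b \<in> hz0)
    \<and> zeta_map (hz_basis []) = 1
    \<and> (\<forall>s. admissible s \<longrightarrow> zeta_map (hz_basis s) = mzv s)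
    \<and> (\<forall>a\<in>hz0. \<forall>b\<in>hz0. zeta_map (a + b) = zeta_map a + zeta_map b)
    \<and> (\<forall>c. \<forall>a\<in>hz0. zeta_map (hz_scale c a) = of_rat c * zeta_map a)
    \<and> (\<forall>a\<in>hz0. \<forall>b\<in>hz0. zeta_map (a \<squnion>\<squnion> b) = zeta_map a * zeta_map b)"
proof (intro conjI allI impI ballI)
  show "mzv_term s summable_on mzv_indices (length s)" if "admissible s" for s
    using has_sum_mzv that by (auto simp: admissible_iff summable_on_def)
  show "zeta_map (hz_basis []) = 1"
    by (simp add: zeta_map_eq_ev mzv_def mzv_indices_0 mzv_term_def)
  show "zeta_map (a \<squnion>\<squnion> b) = zeta_map a * zeta_map b" if "a \<in> hz0" "b \<in> hz0" for a b
    using that by (rule zeta_map_shuffle)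
qed (simp_all add: shuffle_in_hz0 zeta_map_eq_ev hz_eval_add hz_eval_scale)

end
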